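(* There exists a finite set $U$ of non-negative integers with $0\in U$ such that $$1+\frac{\log\left(\frac{|U-U|}{|U+U|}\right)}{\log\left(2\max(U)+1\right)}\;\geq\; 1.173050 .$$ Consequently, for the sums and differences of sets problem, the exponent $\theta$ (defined in the context) satisfies $\theta\geq 1.173050$.
   Context: For finite sets of integers $X,Y$, write $X+Y=\{x+y: x\in X, y\in Y\}$ and $X-Y=\{x-y: x\in X, y\in Y\}$; $|X|$ denotes cardinality. Sums and differences of sets problem: for a real number $K>1$, $\theta$ denotes the largest possible value such that there exist sets of integers $A$ and $B$, with $|A|$ arbitrarily large, satisfying, for some constant $c(K)>0$, both $|A+B|\leq K|A|$ and $|A-B|\geq c(K)\cdot|A+B|^{\theta}$. It is a known result (Gyarmati, Hennecart and Ruzsa) that for every finite set $U$ of non-negative integers containing $0$ one has $\theta\geq 1+\frac{\log(|U-U|/|U+U|)}{\log(2\max(U)+1)}$. *)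

theory Defs
  imports Complex_Main "HOL-Library.Set_Algebras"
begin

text \<open>
  The sumset \<open>X + Y\<close> is the one of \<open>Set_Algebras\<close>. On sets, however, the symbol
  \<open>-\<close> is the set-theoretic difference, so the difference set needs its own constant.
\<close>

definition diffset :: "int set \<Rightarrow> int set \<Rightarrow> int set"
  where "diffset X Y = {x - y | x y. x \<in> X \<and> y \<in> Y}"

text \<open>
  The constant \<open>c\<close> may depend on \<open>K\<close> (and \<open>t\<close>), but not on the sets. The set \<open>B\<close> has to be
  nonempty: since \<open>0 powr t = 0\<close>, the choice \<open>B = {}\<close> would satisfy both inequalities for
  every \<open>t\<close>.
\<close>

definition admissible_exponent :: "real \<Rightarrow> real \<Rightarrow> bool"
  where "admissible_exponent K t \<longleftrightarrow>
    (\<exists>c>0. \<forall>N. \<exists>A B :: int set.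
       finite A \<and> finite B \<and> B \<noteq> {} \<and> N \<le> card A \<and>
       real (card (A + B)) \<le> K * real (card A) \<and>
       real (card (diffset A B)) \<ge> c * real (card (A + B)) powr t)"

definition sumdiff_exponent :: "real \<Rightarrow> real"
  where "sumdiff_exponent K = Sup {t. admissible_exponent K t}"

text \<open>
  The supremum is taken over a nonempty set that is bounded above, so it is a genuine one.
\<close>

lemma admissible_exponent_1:
  assumes "K > 1"
  shows "admissible_exponent K 1"
  unfolding admissible_exponent_def
proof (intro exI[of _ "1::real"] conjI allI)
  fix N
  let ?A = "{0..<int N}"
  have *: "?A + {0} = ?A" "diffset ?A {0} = ?A"
    by (auto simp: set_plus_def diffset_def)
  have "1 * real N \<le> K * real N"
    using assms by (intro mult_right_mono) auto
  then show "\<exists>A B :: int set. finite A \<and> finite B \<and> B \<noteq> {} \<and> N \<le> card A \<and>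
       real (card (A + B)) \<le> K * real (card A) \<and>
       1 * real (card (A + B)) powr 1 \<le> real (card (diffset A B))"
    by (intro exI[of _ ?A] exI[of _ "{0}"]) (simp add: *)
qed simp

lemma card_diffset_le:
  assumes "finite A" "finite B"
  shows "card (diffset A B) \<le> card (A + B) * card (A + B)"
proof (cases "A = {} \<or> B = {}")
  case True
  then have "diffset A B = {}" by (auto simp: diffset_def)
  then show ?thesis by simp
next
  case False
  then obtain a b where ab: "a \<in> A" "b \<in> B" by auto
  have fin: "finite (A + B)" using assms by (rule finite_set_plus)
  have "(\<lambda>x. x + b) ` A \<subseteq> A + B" "(\<lambda>y. a + y) ` B \<subseteq> A + B"
    using ab by (auto intro: set_plus_intro)
  then have le: "card A \<le> card (A + B)" "card B \<le> card (A + B)"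
    using fin card_inj_on_le[of "\<lambda>x. x + b" A "A + B"] card_inj_on_le[of "\<lambda>y. a + y" B "A + B"]
    by (simp_all add: inj_on_def)
  have "diffset A B = (\<lambda>(x, y). x - y) ` (A \<times> B)"
    by (auto simp: diffset_def)
  then have "card (diffset A B) \<le> card A * card B"
    using card_image_le[of "A \<times> B" "\<lambda>(x, y). x - y"] assms
    by (simp add: card_cartesian_product)
  also have "\<dots> \<le> card (A + B) * card (A + B)"
    using le by (rule mult_le_mono)
  finally show ?thesis .
qed

lemma admissible_exponent_le_2:
  assumes "admissible_exponent K t"
  shows "t \<le> 2"
proof (rule ccontr)
  assume "\<not> t \<le> 2"
  then have t: "t > 2" by simp
  obtain c where c: "c > 0" and AB: "\<And>N. \<exists>A B :: int set.
       finite A \<and> finite B \<and> B \<noteq> {} \<and> N \<le> card A \<and>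
       real (card (A + B)) \<le> K * real (card A) \<and>
       real (card (diffset A B)) \<ge> c * real (card (A + B)) powr t"
    using assms unfolding admissible_exponent_def by blast
  define R where "R = (1 / c) powr (1 / (t - 2))"
  obtain N where N: "real N > R" using reals_Archimedean2 by blast
  obtain A B :: "int set" where fin: "finite A" "finite B" and B: "B \<noteq> {}"
    and A: "Suc N \<le> card A"
    and ge: "real (card (diffset A B)) \<ge> c * real (card (A + B)) powr t"
    using AB[of "Suc N"] by blast
  define s where "s = real (card (A + B))"
  obtain b where b: "b \<in> B" using B by auto
  have "card A \<le> card (A + B)"
    using b fin by (intro card_inj_on_le[where f = "\<lambda>x. x + b"])
      (auto simp: inj_on_def intro: set_plus_intro finite_set_plus)
  then have s: "s > R" "s > 0" using A N unfolding s_def by linarith+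
  have "c * s powr t \<le> s * s"
    using ge card_diffset_le[OF fin] unfolding s_def
    by (metis of_nat_le_iff of_nat_mult order_trans)
  moreover have "s powr t = s powr (t - 2) * (s * s)"
    using s by (simp add: powr_diff powr_numeral power2_eq_square)
  ultimately have "c * s powr (t - 2) \<le> 1"
    using s by (simp add: mult.assoc[symmetric])
  moreover have "1 / c < s powr (t - 2)"
  proof -
    have "1 / c = R powr (t - 2)" using t c by (simp add: R_def powr_powr)
    also have "\<dots> < s powr (t - 2)"
      using s t by (intro powr_less_mono2) (auto simp: R_def)
    finally show ?thesis .
  qed
  ultimately show False using c by (simp add: field_simps)
qed

end

theory Submission
  imports Defs
begin

text \<open>
  \<^emph>\<open>From \<open>U\<close> to \<open>\<theta>\<close>.\<close> Let \<open>q = 2 max U + 1\<close> and let \<open>V\<close> be the set of integers with \<open>k\<close> base-\<open>q\<close> digits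
  in \<open>U\<close>, so that \<open>V + V\<close> and \<open>V - V\<close> have at most \<open>|U + U|\<^sup>k\<close> and at least \<open>|U - U|\<^sup>k\<close> elements. Take
  \<open>B = V\<close> and let \<open>A\<close> be an interval of length \<open>C q\<^sup>k\<close> together with about \<open>(q / |U + U|)\<^sup>k\<close> far apart
  translates of \<open>V\<close>. The interval makes \<open>|A + B| / |A|\<close> as close to \<open>1\<close> as desired, and the
  translates contribute \<open>O(q\<^sup>k)\<close> sums but \<open>(q |U - U| / |U + U|)\<^sup>k\<close> differences.

  \<^emph>\<open>The set \<open>U\<close>.\<close> Take the integers with \<open>n\<close> digits in \<open>{0..m}\<close> in base \<open>2 m + 1\<close> whose digit sum is at
  most \<open>L\<close>. For every weight \<open>t \<le> 1\<close>, Rankin's trick bounds \<open>t\<^bsup>2 L\<^esup> |U + U|\<close> from above by \<open>R\<^sup>n\<close> with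
  \<open>R = 1 + t + \<dots> + t\<^bsup>2 m\<^esup>\<close>, while for a suitable \<open>L\<close> the pigeonhole principle bounds \<open>t\<^bsup>2 L\<^esup> |U - U|\<close>
  from below by \<open>S\<^sup>n\<close> up to a polynomial factor, with \<open>S = 1 + 2 t + \<dots> + 2 t\<^sup>m\<close>. The exponent
  thus approaches \<open>1 + log (S / R) / log (2 m + 1)\<close>, which for \<open>m = 5\<close> and \<open>t = 62/99\<close> slightly
  exceeds \<open>1 + 9/52\<close>.
\<close>

subsection \<open>Base-\<open>q\<close> expansions\<close>

abbreviation words :: "nat \<Rightarrow> 'a set \<Rightarrow> 'a list set"
  where "words n A \<equiv> {xs. set xs \<subseteq> A \<and> length xs = n}"

abbreviation num :: "int \<Rightarrow> int list \<Rightarrow> int"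
  where "num q \<equiv> horner_sum (\<lambda>x. x) q"

text \<open>Multiplying out the power gives one term per word. With powers of \<open>t\<close> as
  letter weights, this is the generating function behind both weighted counts below.\<close>

lemma sum_prod_list_words:
  fixes f :: "'a \<Rightarrow> 'b::comm_semiring_1"
  shows "(\<Sum>xs\<in>words n A. prod_list (map f xs)) = sum f A ^ n"
proof (induction n)
  case 0
  have "words 0 A = {[]}" by auto
  then show ?case by simp
next
  case (Suc n)
  have "(\<Sum>xs\<in>words (Suc n) A. prod_list (map f xs))
      = (\<Sum>(xs, x)\<in>words n A \<times> A. f x * prod_list (map f xs))"
    by (subst lists_length_Suc_eq, subst sum.reindex)
      (auto simp: inj_on_def intro!: sum.cong)
  also have "\<dots> = (\<Sum>x\<in>A. f x) * (\<Sum>xs\<in>words n A. prod_list (map f xs))"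
    by (simp add: sum.cartesian_product[symmetric] sum_distrib_left sum_distrib_right)
  finally show ?case using Suc by simp
qed

lemma num_add:
  "length xs = length ys \<Longrightarrow> num q (map2 (+) xs ys) = num q xs + num q ys"
  by (induction xs ys rule: list_induct2) (auto simp: algebra_simps)

lemma num_diff:
  "length xs = length ys \<Longrightarrow> num q (map2 (-) xs ys) = num q xs - num q ys"
  by (induction xs ys rule: list_induct2) (auto simp: right_diff_distrib)

lemma num_nonneg: "0 \<le> q \<Longrightarrow> set xs \<subseteq> {0..} \<Longrightarrow> 0 \<le> num q xs"
  by (induction xs) auto

text \<open>This is the geometric series with \<open>2 * M \<le> q - 1\<close>. The factor 2 keeps
  the difference of two such numbers below \<open>q ^ n\<close>, which separates translates by
  multiples of \<open>q ^ n\<close>.\<close>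

lemma num_bound:
  assumes "2 * M < q" "0 \<le> M"
  shows "xs \<in> words n {-M..M} \<Longrightarrow> 2 * \<bar>num q xs\<bar> < q ^ n"
proof (induction n arbitrary: xs)
  case (Suc n)
  then obtain x ys where xs: "xs = x # ys" "ys \<in> words n {-M..M}" "\<bar>x\<bar> \<le> M"
    by (cases xs) auto
  have "2 * \<bar>num q ys\<bar> \<le> q ^ n - 1" using Suc.IH[OF xs(2)] by simp
  then have "q * (2 * \<bar>num q ys\<bar>) \<le> q * (q ^ n - 1)"
    using assms by (intro mult_left_mono) auto
  moreover have "\<bar>x + q * num q ys\<bar> \<le> \<bar>x\<bar> + q * \<bar>num q ys\<bar>"
    using assms abs_triangle_ineq[of x "q * num q ys"] by (simp add: abs_mult)
  ultimately show ?case
    using xs assms by (simp add: algebra_simps)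
qed simp

text \<open>Reduce modulo \<open>q\<close>. Here \<open>x\<close> and \<open>y\<close> are the
  lowest digits, or later whole blocks of \<open>k\<close> digits with a \<open>k\<close>-th power
  as the base.\<close>

lemma leading_digit_unique:
  fixes x y a b q :: int
  assumes "x + q * a = y + q * b" "\<bar>x - y\<bar> < q"
  shows "x = y \<and> a = b"
proof -
  have "x - y = q * (b - a)" using assms(1) by (simp add: algebra_simps)
  then have "q dvd x - y" by simp
  then have "x - y = 0" using assms(2) dvd_imp_le_int[of "x - y" q] by fastforce
  then show ?thesis using assms by auto
qed

lemma num_inj:
  assumes "2 * M < q"
  shows "inj_on (num q) (words n {-M..M})"
proof (induction n)
  case (Suc n)
  show ?case
  proof (rule inj_onI)
    fix xs ys assume H: "xs \<in> words (Suc n) {-M..M}" "ys \<in> words (Suc n) {-M..M}"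
      "num q xs = num q ys"
    obtain x xs' where xs: "xs = x # xs'" using H by (cases xs) auto
    obtain y ys' where ys: "ys = y # ys'" using H by (cases ys) auto
    have "\<bar>x - y\<bar> < q" using H xs ys assms by auto
    then have "x = y \<and> num q xs' = num q ys'"
      using H(3) unfolding xs ys by (intro leading_digit_unique[of x q _ y]) auto
    then show "xs = ys"
      using H xs ys Suc by (auto dest: inj_onD)
  qed
qed (auto simp: inj_on_def)

text \<open>Adding digit by digit, without carries, writes every sum as the value of a word over
  \<open>U + U\<close>.\<close>

lemma card_set_plus_num_words:
  fixes U :: "int set"
  assumes "finite U"
  shows "card (num q ` words k U + num q ` words k U) \<le> card (U + U) ^ k"
proof -
  have "num q ` words k U + num q ` words k U \<subseteq> num q ` words k (U + U)"
  proof
    fix z assume "z \<in> num q ` words k U + num q ` words k U"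
    then obtain xs ys where *: "xs \<in> words k U" "ys \<in> words k U" "z = num q xs + num q ys"
      by (auto simp: set_plus_def)
    then have "z = num q (map2 (+) xs ys)" by (simp add: num_add)
    moreover have "map2 (+) xs ys \<in> words k (U + U)"
      using * by (auto intro!: set_plus_intro dest: set_zip_leftD set_zip_rightD)
    ultimately show "z \<in> num q ` words k (U + U)" by blast
  qed
  moreover have "finite (words k (U + U))"
    using assms by (intro finite_lists_length_eq finite_set_plus)
  ultimately have "card (num q ` words k U + num q ` words k U) \<le> card (words k (U + U))"
    by (meson card_image_le card_mono finite_imageI order_trans)
  then show ?thesis
    using assms by (simp add: card_lists_length_eq finite_set_plus)
qed

lemma num_words_diffset:
  "num q ` words k (diffset U V) \<subseteq> diffset (num q ` words k U) (num q ` words k V)"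
proof
  fix z assume "z \<in> num q ` words k (diffset U V)"
  then obtain zs where z: "z = num q zs" "zs \<in> words k (diffset U V)" by auto
  have "zs \<in> words k (diffset U V) \<Longrightarrow> \<exists>xs\<in>words k U. \<exists>ys\<in>words k V. zs = map2 (-) xs ys"
  proof (induction k arbitrary: zs)
    case (Suc k)
    then obtain w ws where zs: "zs = w # ws" "ws \<in> words k (diffset U V)" "w \<in> diffset U V"
      by (cases zs) auto
    obtain xs ys where "xs \<in> words k U" "ys \<in> words k V" "ws = map2 (-) xs ys"
      using Suc.IH[OF zs(2)] by blast
    moreover obtain x y where "x \<in> U" "y \<in> V" "w = x - y"
      using zs(3) by (auto simp: diffset_def)
    ultimately show ?case
      using zs(1) by (intro bexI[of _ "x # xs"] bexI[of _ "y # ys"]) auto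
  qed auto
  then obtain xs ys where "xs \<in> words k U" "ys \<in> words k V" "zs = map2 (-) xs ys"
    using z by blast
  then show "z \<in> diffset (num q ` words k U) (num q ` words k V)"
    using z num_diff[of xs ys q] unfolding diffset_def by auto
qed

lemma finite_diffset: "finite A \<Longrightarrow> finite B \<Longrightarrow> finite (diffset A B)"
  by (rule finite_subset[of _ "(\<lambda>(x, y). x - y) ` (A \<times> B)"]) (auto simp: diffset_def)

subsection \<open>The bound of Gyarmati, Hennecart and Ruzsa\<close>

lemma admissible_exponent_GHR:
  fixes U :: "int set"
  assumes U: "finite U" "\<forall>u\<in>U. 0 \<le> u" "0 \<in> U" and Max_pos: "Max U > 0" and "K > 1"
  shows "admissible_exponent K (1 + ln (real (card (diffset U U)) / real (card (U + U)))
                  / ln (2 * real_of_int (Max U) + 1))"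
proof -
  define M where "M = Max U"
  define q where "q = nat (2 * M + 1)"
  have M: "M > 0" "U \<subseteq> {0..M}" using assms by (auto simp: M_def)
  have q: "int q = 2 * M + 1" "q > 1" using M by (auto simp: q_def)
  define s where "s = card (U + U)"
  define D where "D = card (diffset U U)"
  have bounds: "0 \<le> u \<and> u \<le> M" if "u \<in> U" for u using that M by auto
  have "U + U \<subseteq> {0..2 * M}" by (auto elim!: set_plus_elim dest!: bounds)
  then have "s \<le> card {0..2 * M}" unfolding s_def by (intro card_mono) auto
  then have sq: "s \<le> q" by (simp add: q_def)
  have "0 \<in> U + U" using U by (force simp: set_plus_def)
  then have s: "s > 0" using U by (auto simp: s_def card_gt_0_iff finite_set_plus)
  have diff_sub: "diffset U U \<subseteq> {-M..M}" by (auto simp: diffset_def dest!: bounds)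
  have "0 \<in> diffset U U" using U by (force simp: diffset_def)
  then have D: "D > 0" using U by (auto simp: D_def card_gt_0_iff finite_diffset)
  \<comment> \<open>This is the solution of \<open>q powr \<theta> = q * D / s\<close>.\<close>
  define \<theta> where "\<theta> = 1 + ln (real D / real s) / ln (real q)"
  have powr_\<theta>: "real (q ^ k) powr \<theta> = (real q * real D / real s) ^ k" for k
  proof -
    have "\<theta> * ln (real q) = ln (real q) + ln (real D / real s)"
      using q by (simp add: \<theta>_def field_simps)
    then have "real q powr \<theta> = real q * real D / real s"
      using q s D by (simp add: powr_def exp_add)
    moreover have "real (q ^ k) powr \<theta> = (real q powr \<theta>) ^ k"
      using q by (simp add: powr_realpow[symmetric] powr_powr mult.commute)
    ultimately show ?thesis by simp
  qed
  \<comment> \<open>Makes \<open>powr \<theta>\<close> monotone; the reason is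
    \<open>D \<ge> 1\<close> together with \<open>s \<le> q\<close>.\<close>
  have \<theta>: "\<theta> \<ge> 0"
  proof -
    have "1 / real q \<le> real D / real s"
      using sq s D by (intro frac_le) auto
    then have "ln (1 / real q) \<le> ln (real D / real s)"
      using q by (intro ln_mono) auto
    then show ?thesis using q by (simp add: \<theta>_def field_simps ln_div)
  qed
  \<comment> \<open>With this choice the bound \<open>(C + 3) * q ^ k\<close> on the number of sums
    is at most \<open>K\<close> times the length \<open>C * q ^ k\<close> of the interval.\<close>
  define C where "C = nat \<lceil>3 / (K - 1)\<rceil> + 1"
  have "3 / (K - 1) \<le> real C" unfolding C_def by linarith
  then have C: "real C + 3 \<le> K * real C" "C \<ge> 1" using \<open>K > 1\<close> by (auto simp: field_simps C_def)
  have "real q = 2 * real_of_int (Max U) + 1"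
    using M by (simp add: q_def M_def)
  then have \<theta>_eq: "1 + ln (real (card (diffset U U)) / real (card (U + U)))
      / ln (2 * real_of_int (Max U) + 1) = \<theta>"
    by (simp add: \<theta>_def D_def s_def)
  show ?thesis
    unfolding \<theta>_eq admissible_exponent_def
  \<comment> \<open>The constant undoes the factor \<open>C + 3\<close> lost in comparing the number
    of sums with \<open>Q\<close>.\<close>
  proof (intro exI[of _ "(real C + 3) powr - \<theta>"] conjI allI)
    fix N :: nat
    \<comment> \<open>As \<open>N < q ^ N\<close>, the interval alone will have at least
      \<open>N\<close> elements.\<close>
    define k where "k = N"
    define Q where "Q = q ^ k"
    \<comment> \<open>Rounding up gives \<open>r * s ^ k \<ge> Q\<close>, hence many differences,
      while \<open>s \<le> q\<close> keeps \<open>r * s ^ k \<le> 2 * Q\<close>, hence few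
      sums.\<close>
    define r where "r = Q div s ^ k + 1"
    define V where "V = num (int q) ` words k U"
    define I where "I = {0..<int (C * Q)}"
    define T where "T = (\<lambda>(v, i). v + int Q * i) ` (V \<times> {0..<int r})"
    have finV: "finite V" unfolding V_def using U by (intro finite_imageI finite_lists_length_eq)
    have V2: "2 * v < int Q" "0 \<le> v" if "v \<in> V" for v
    proof -
      obtain xs where xs: "xs \<in> words k U" "v = num (int q) xs"
        using \<open>v \<in> V\<close> by (auto simp: V_def)
      have "set xs \<subseteq> {-M..M}" "set xs \<subseteq> {0..}"
        using xs(1) by (auto dest!: subsetD bounds)
      then show "2 * v < int Q" "0 \<le> v"
        using num_bound[of M "int q" xs k] num_nonneg[of "int q" xs] M q xs by (auto simp: Q_def)
    qed
    have "replicate k 0 \<in> words k U" using U by auto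
    then have V_ne: "V \<noteq> {}" unfolding V_def by blast
    have fin: "finite (I \<union> T)" using finV by (auto simp: I_def T_def)
    have N: "N \<le> card (I \<union> T)" and cardI: "C * Q \<le> card (I \<union> T)"
    proof -
      have "card I \<le> card (I \<union> T)" using fin by (intro card_mono) auto
      moreover have "card I = C * Q" by (simp add: I_def del: of_nat_mult)
      ultimately show "C * Q \<le> card (I \<union> T)" by simp
      moreover have "k \<le> C * Q"
        using mult_le_mono[of 1 C k Q] C(2) power_gt_expt[of q k] q(2) by (simp add: Q_def)
      ultimately show "N \<le> card (I \<union> T)" by (simp add: k_def)
    qed
    \<comment> \<open>Of the \<open>3 * Q\<close>, one \<open>Q\<close> is the overshoot of
      \<open>I + V\<close> beyond \<open>I\<close>; the other two bound the translates of
      \<open>V + V\<close>.\<close>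
    have "card ((I \<union> T) + V) \<le> C * Q + 3 * Q"
    proof -
      have "(I \<union> T) + V \<subseteq> {0..<int (C * Q + Q)}
          \<union> (\<lambda>(w, i). w + int Q * i) ` ((V + V) \<times> {0..<int r})"
      proof
        fix z assume "z \<in> (I \<union> T) + V"
        then obtain a v where av: "a \<in> I \<union> T" "v \<in> V" "z = a + v"
          by (auto simp: set_plus_def)
        show "z \<in> {0..<int (C * Q + Q)}
          \<union> (\<lambda>(w, i). w + int Q * i) ` ((V + V) \<times> {0..<int r})"
        proof (cases "a \<in> I")
          case True
          then show ?thesis using av V2[of v] by (auto simp: I_def)
        next
          case False
          then obtain w i where "w \<in> V" "i \<in> {0..<int r}" "a = w + int Q * i"
            using av by (auto simp: T_def)
          then have "z = (w + v) + int Q * i" "w + v \<in> V + V"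
            using av by (auto simp: set_plus_def)
          then show ?thesis using \<open>i \<in> _\<close> by (intro UnI2 image_eqI[of _ _ "(w + v, i)"]) auto
        qed
      qed
      then have "card ((I \<union> T) + V) \<le> card ({0..<int (C * Q + Q)}
          \<union> (\<lambda>(w, i). w + int Q * i) ` ((V + V) \<times> {0..<int r}))"
        using finV by (intro card_mono) (auto intro: finite_set_plus)
      also have "\<dots> \<le> card {0..<int (C * Q + Q)} + card ((V + V) \<times> {0..<int r})"
        using finV by (intro order.trans[OF card_Un_le] add_mono card_image_le)
          (auto intro: finite_set_plus)
      also have "\<dots> \<le> (C * Q + Q) + s ^ k * r"
        using card_set_plus_num_words[OF U(1), of "int q" k]
        by (auto simp: card_cartesian_product V_def s_def simp del: of_nat_mult of_nat_add)
      also have "s ^ k * r \<le> Q + Q"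
        using sq by (auto simp: r_def Q_def algebra_simps intro!: add_mono power_mono)
      finally show ?thesis by simp
    qed
    then have card_sum: "real (card ((I \<union> T) + V)) \<le> (real C + 3) * real Q"
      by (simp only: of_nat_le_iff[where 'a = real, symmetric]) (simp add: algebra_simps)
    have "r * D ^ k \<le> card (diffset (I \<union> T) V)"
    proof -
      define W where "W = num (int q) ` words k (diffset U U)"
      have "inj_on (num (int q)) (words k (diffset U U))"
        using num_inj[of M "int q" k] diff_sub q by (auto intro: inj_on_subset)
      then have cardW: "card W = D ^ k"
        using U by (simp add: W_def card_image card_lists_length_eq finite_diffset D_def)
      have W2: "2 * \<bar>w\<bar> < int Q" if "w \<in> W" for w
      proof -
        obtain xs where xs: "xs \<in> words k (diffset U U)" "w = num (int q) xs"
          using \<open>w \<in> W\<close> by (auto simp: W_def)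
        then show ?thesis
          using num_bound[of M "int q" xs k] M q diff_sub by (auto simp: Q_def)
      qed
      \<comment> \<open>Elements of \<open>W\<close> are residues of least absolute value modulo
        \<open>Q\<close>, so the translates of \<open>W\<close> are disjoint.\<close>
      have "inj_on (\<lambda>(w, i). w + int Q * i) (W \<times> {0..<int r})"
      proof -
        have "(w, i) = (w', i')"
          if "w \<in> W" "w' \<in> W" "w + int Q * i = w' + int Q * i'" for w w' i i'
          using leading_digit_unique[OF that(3)] W2[OF that(1)] W2[OF that(2)] by auto
        then show ?thesis by (intro inj_onI, clarify) (metis prod.inject)
      qed
      then have "card ((\<lambda>(w, i). w + int Q * i) ` (W \<times> {0..<int r})) = r * D ^ k"
        by (simp add: card_image card_cartesian_product cardW)
      moreover have "(\<lambda>(w, i). w + int Q * i) ` (W \<times> {0..<int r}) \<subseteq> diffset (I \<union> T) V"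
      proof clarify
        fix w i assume "w \<in> W" and i: "i \<in> {0..<int r}"
        then have "w \<in> diffset V V" using num_words_diffset unfolding W_def V_def by blast
        then obtain x y where xy: "x \<in> V" "y \<in> V" "w = x - y" by (auto simp: diffset_def)
        have "x + int Q * i \<in> T" using xy i by (force simp: T_def)
        moreover have "w + int Q * i = (x + int Q * i) - y" using xy by simp
        ultimately show "w + int Q * i \<in> diffset (I \<union> T) V"
          using xy(2) unfolding diffset_def by blast
      qed
      ultimately show ?thesis using finite_diffset[OF fin finV] by (metis card_mono)
    qed
    moreover have "(real q * real D / real s) ^ k \<le> real (r * D ^ k)"
    proof -
      have "Q \<le> r * s ^ k"
        using dividend_less_div_times[of "s ^ k" "Q"] s by (simp add: r_def)
      then have "real q ^ k \<le> real r * real s ^ k"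
        using of_nat_mono[of Q "r * s ^ k", where 'a = real] by (simp add: Q_def)
      then have "real q ^ k / real s ^ k \<le> real r"
        using s by (simp add: divide_le_eq)
      then have "real q ^ k / real s ^ k * real D ^ k \<le> real r * real D ^ k"
        by (intro mult_right_mono) auto
      then show ?thesis by (simp add: power_divide power_mult_distrib)
    qed
    ultimately have card_diff: "real Q powr \<theta> \<le> real (card (diffset (I \<union> T) V))"
      unfolding Q_def powr_\<theta> by linarith
    have "(real C + 3) powr - \<theta> * real (card ((I \<union> T) + V)) powr \<theta>
        \<le> (real C + 3) powr - \<theta> * ((real C + 3) * real Q) powr \<theta>"
      using card_sum \<theta> by (intro mult_left_mono powr_mono2) auto
    also have "\<dots> = real Q powr \<theta>"
      by (simp add: powr_mult powr_minus)
    finally have *: "(real C + 3) powr - \<theta> * real (card ((I \<union> T) + V)) powr \<theta>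
        \<le> real (card (diffset (I \<union> T) V))"
      using card_diff by linarith
    have "(real C + 3) * real Q \<le> K * real C * real Q"
      using C by (intro mult_right_mono) auto
    also have "\<dots> = K * real (C * Q)" by simp
    also have "\<dots> \<le> K * real (card (I \<union> T))"
      using cardI \<open>K > 1\<close> by (intro mult_left_mono) (simp_all only: of_nat_le_iff)
    finally have "real (card ((I \<union> T) + V)) \<le> K * real (card (I \<union> T))"
      using card_sum by linarith
    then show "\<exists>A B :: int set. finite A \<and> finite B \<and> B \<noteq> {} \<and> N \<le> card A \<and>
       real (card (A + B)) \<le> K * real (card A) \<and>
       (real C + 3) powr - \<theta> * real (card (A + B)) powr \<theta> \<le> real (card (diffset A B))"
      using fin finV V_ne N * by (intro exI[of _ "I \<union> T"] exI[of _ V] conjI)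
  qed (use C in auto)
qed


subsection \<open>Digit sets with bounded digit sum\<close>

abbreviation pos_sum :: "int list \<Rightarrow> nat"
  where "pos_sum xs \<equiv> sum_list (map nat xs)"

abbreviation neg_sum :: "int list \<Rightarrow> nat"
  where "neg_sum xs \<equiv> sum_list (map (\<lambda>x. nat (- x)) xs)"

definition simplex_set :: "nat \<Rightarrow> nat \<Rightarrow> nat \<Rightarrow> int set"
  where "simplex_set m n L =
    num (2 * int m + 1) ` {xs \<in> words n {0..int m}. pos_sum xs \<le> L}"

lemma finite_words_int: "finite (words n {a..b::int})"
  by (intro finite_lists_length_eq) simp

lemma pos_sum_map2_add:
  "length xs = length ys \<Longrightarrow> set xs \<subseteq> {0..} \<Longrightarrow> set ys \<subseteq> {0..} \<Longrightarrow>
    pos_sum (map2 (+) xs ys) = pos_sum xs + pos_sum ys"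
  by (induction xs ys rule: list_induct2) (auto simp: nat_add_distrib)

lemma prod_list_power_pos_sum:
  "prod_list (map (\<lambda>x. t ^ nat x) xs) = (t::'a::comm_monoid_mult) ^ pos_sum xs"
  by (induction xs) (auto simp: power_add)

lemma prod_list_power_abs_sum:
  "prod_list (map (\<lambda>x. t ^ nat \<bar>x\<bar>) xs) = (t::'a::comm_monoid_mult) ^ (pos_sum xs + neg_sum xs)"
proof (induction xs)
  case (Cons x xs)
  have "nat \<bar>x\<bar> = nat x + nat (- x)" by simp
  then show ?case using Cons by (simp add: power_add ac_simps)
qed simp

text \<open>At \<open>u = Max U\<close>, the quantity \<open>2 * u + 1\<close> is the one whose
  logarithm is the denominator of the exponent.\<close>

lemma simplex_set_bounds:
  assumes "u \<in> simplex_set m n L"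
  shows "0 \<le> u" "2 * u + 1 \<le> (2 * int m + 1) ^ n"
proof -
  obtain xs where xs: "xs \<in> words n {0..int m}" "u = num (2 * int m + 1) xs"
    using assms by (auto simp: simplex_set_def)
  have "set xs \<subseteq> {0..}" "set xs \<subseteq> {- int m..int m}" using xs(1) by auto
  then show "0 \<le> u" "2 * u + 1 \<le> (2 * int m + 1) ^ n"
    using num_nonneg[of "2 * int m + 1" xs] num_bound[of "int m" "2 * int m + 1" xs n] xs by auto
qed

lemma finite_simplex_set: "finite (simplex_set m n L)"
  unfolding simplex_set_def
  by (intro finite_imageI finite_subset[OF _ finite_words_int[of 0 "int m" n]]) auto

lemma zero_in_simplex_set: "0 \<in> simplex_set m n L"
proof -
  have "num q (replicate n 0) = 0" for q by (induction n) auto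
  then show ?thesis
    unfolding simplex_set_def
    by (intro image_eqI[of _ _ "replicate n 0"]) (auto simp: sum_list_replicate)
qed

lemma card_simplex_sumset_le:
  fixes t :: real
  assumes "0 < t" "t \<le> 1"
  shows "t ^ (2 * L) * real (card (simplex_set m n L + simplex_set m n L))
    \<le> (\<Sum>x\<in>{0..2 * int m}. t ^ nat x) ^ n"
proof -
  define Z where "Z = {zs \<in> words n {0..2 * int m}. pos_sum zs \<le> 2 * L}"
  have finZ: "finite Z"
    unfolding Z_def by (rule finite_subset[OF _ finite_words_int[of 0 "2 * int m" n]]) auto
  have "simplex_set m n L + simplex_set m n L \<subseteq> num (2 * int m + 1) ` Z"
  proof
    fix z assume "z \<in> simplex_set m n L + simplex_set m n L"
    then obtain xs ys where *: "xs \<in> words n {0..int m}" "pos_sum xs \<le> L"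
      "ys \<in> words n {0..int m}" "pos_sum ys \<le> L"
      and z: "z = num (2 * int m + 1) xs + num (2 * int m + 1) ys"
      by (auto simp: simplex_set_def set_plus_def)
    have len: "length xs = length ys" using * by simp
    have "set xs \<subseteq> {0..}" "set ys \<subseteq> {0..}" using * by auto
    then have "pos_sum (map2 (+) xs ys) \<le> 2 * L"
      using pos_sum_map2_add[OF len] * by simp
    moreover have "0 \<le> x + y \<and> x + y \<le> 2 * int m" if "(x, y) \<in> set (zip xs ys)" for x y
    proof -
      have "x \<in> {0..int m}" "y \<in> {0..int m}"
        using * set_zip_leftD[OF that] set_zip_rightD[OF that] by blast+
      then show ?thesis by simp
    qed
    then have "set (map2 (+) xs ys) \<subseteq> {0..2 * int m}" by auto
    ultimately have "map2 (+) xs ys \<in> Z" using * by (simp add: Z_def)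
    then show "z \<in> num (2 * int m + 1) ` Z" using z num_add[OF len] by (metis image_eqI)
  qed
  then have "card (simplex_set m n L + simplex_set m n L) \<le> card Z"
    using finZ by (meson card_image_le card_mono finite_imageI order_trans)
  then have "t ^ (2 * L) * real (card (simplex_set m n L + simplex_set m n L))
      \<le> t ^ (2 * L) * real (card Z)"
    using assms by (intro mult_left_mono) auto
  also have "\<dots> = (\<Sum>zs\<in>Z. t ^ (2 * L))" by simp
  \<comment> \<open>Rankin's trick: \<open>t \<le> 1\<close> and the digit sum is at most
    \<open>2 * L\<close>. The constraint on the digit sum is then dropped.\<close>
  also have "\<dots> \<le> (\<Sum>zs\<in>Z. prod_list (map (\<lambda>x. t ^ nat x) zs))"
    using assms unfolding prod_list_power_pos_sum
    by (intro sum_mono power_decreasing) (auto simp: Z_def)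
  also have "\<dots> \<le> (\<Sum>zs\<in>words n {0..2 * int m}. prod_list (map (\<lambda>x. t ^ nat x) zs))"
    using assms finite_words_int unfolding prod_list_power_pos_sum
    by (intro sum_mono2) (auto simp: Z_def)
  also have "\<dots> = (\<Sum>x\<in>{0..2 * int m}. t ^ nat x) ^ n"
    by (rule sum_prod_list_words)
  finally show ?thesis .
qed

text \<open>A signed word is its positive part minus its negative part, and both parts obey the
  digit sum bound.\<close>

lemma simplex_diffset_memI:
  assumes "zs \<in> words n {- int m..int m}" "pos_sum zs \<le> L" "neg_sum zs \<le> L"
  shows "num (2 * int m + 1) zs \<in> diffset (simplex_set m n L) (simplex_set m n L)"
proof -
  define xs where "xs = map (max 0) zs"
  define ys where "ys = map (\<lambda>z. max 0 (- z)) zs"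
  have "pos_sum xs = pos_sum zs" "pos_sum ys = neg_sum zs"
    unfolding xs_def ys_def by (induction zs) auto
  then have "xs \<in> {xs \<in> words n {0..int m}. pos_sum xs \<le> L}"
    "ys \<in> {xs \<in> words n {0..int m}. pos_sum xs \<le> L}"
    using assms by (auto simp: xs_def ys_def subset_iff)
  moreover have "num q zs = num q xs - num q ys" for q
    unfolding xs_def ys_def by (induction zs) (auto simp: right_diff_distrib)
  ultimately show ?thesis unfolding diffset_def simplex_set_def by blast
qed

text \<open>
  Some profile \<open>(a, b)\<close> of positive and negative part carries a polynomial fraction of the
  weighted count. Concatenating a word of this profile with the negative of another one
  balances the two parts.
\<close>

lemma card_simplex_diffset_ge:
  fixes t :: real
  assumes "0 < t"
  obtains L where "(\<Sum>x\<in>{- int m..int m}. t ^ nat \<bar>x\<bar>) ^ (2 * n) \<le> (real (m * n) + 1) ^ 4 *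
    (t ^ (2 * L) * real (card (diffset (simplex_set m (2 * n) L) (simplex_set m (2 * n) L))))"
proof -
  define S where "S = (\<Sum>x\<in>{- int m..int m}. t ^ nat \<bar>x\<bar>)"
  define W where "W = words n {- int m..int m}"
  define Z where "Z = (\<lambda>(a, b). {zs \<in> W. pos_sum zs = a \<and> neg_sum zs = b})"
  \<comment> \<open>The possible profiles: each part of a word of length \<open>n\<close> sums to at
    most \<open>m * n\<close>.\<close>
  define P where "P = {0..m * n} \<times> {0..m * n}"
  have finW: "finite W" unfolding W_def by (rule finite_words_int)
  have sums_le: "pos_sum zs \<le> m * length zs \<and> neg_sum zs \<le> m * length zs"
    if "set zs \<subseteq> {- int m..int m}" for zs
    using that by (induction zs) auto
  then have "(\<lambda>zs. (pos_sum zs, neg_sum zs)) ` W \<subseteq> P"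
    by (auto simp: W_def P_def)
  then have "(\<Sum>zs\<in>W. t ^ (pos_sum zs + neg_sum zs))
      = (\<Sum>p\<in>P. \<Sum>zs\<in>{zs \<in> W. (pos_sum zs, neg_sum zs) = p}. t ^ (pos_sum zs + neg_sum zs))"
    by (intro sum.group[symmetric] finW) (auto simp: P_def)
  also have "\<dots> = (\<Sum>p\<in>P. real (card (Z p)) * t ^ (fst p + snd p))"
    by (intro sum.cong refl) (auto simp: Z_def split: prod.splits)
  finally have S_eq: "S ^ n = (\<Sum>p\<in>P. real (card (Z p)) * t ^ (fst p + snd p))"
    using sum_prod_list_words[where f = "\<lambda>x. t ^ nat \<bar>x\<bar>" and n = n and A = "{- int m..int m}"]
    by (simp add: W_def S_def prod_list_power_abs_sum)
  obtain p where p: "\<And>p'. p' \<in> P \<Longrightarrow> real (card (Z p')) * t ^ (fst p' + snd p')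
      \<le> real (card (Z p)) * t ^ (fst p + snd p)"
  proof -
    define w where "w p = real (card (Z p)) * t ^ (fst p + snd p)" for p
    have "finite (w ` P)" "w ` P \<noteq> {}" by (auto simp: P_def)
    then have "Max (w ` P) \<in> w ` P" "\<And>p'. p' \<in> P \<Longrightarrow> w p' \<le> Max (w ` P)"
      by (auto intro: Max_in Max_ge)
    then show ?thesis using that unfolding w_def by force
  qed
  have "S ^ n \<le> (\<Sum>p'\<in>P. real (card (Z p)) * t ^ (fst p + snd p))"
    unfolding S_eq by (intro sum_mono p)
  then have S_le: "S ^ n \<le> (real (m * n) + 1)\<^sup>2 * (real (card (Z p)) * t ^ (fst p + snd p))"
    by (simp add: P_def card_cartesian_product power2_eq_square algebra_simps)
  \<comment> \<open>Negating the second word swaps its two parts, so both parts of the concatenation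
    equal this sum.\<close>
  define L where "L = fst p + snd p"
  define f where "f = (\<lambda>(zs, zs'). num (2 * int m + 1) (zs @ map uminus zs'))"
  have cat: "zs @ map uminus zs' \<in> words (2 * n) {- int m..int m}
      \<and> pos_sum (zs @ map uminus zs') = L \<and> neg_sum (zs @ map uminus zs') = L"
    if "zs \<in> Z p" "zs' \<in> Z p" for zs zs'
    using that by (auto simp: Z_def W_def L_def o_def subset_iff split: prod.splits)
  have "inj_on f (Z p \<times> Z p)"
  proof (intro inj_onI, clarify)
    fix xs xs' ys ys'
    assume *: "xs \<in> Z p" "xs' \<in> Z p" "ys \<in> Z p" "ys' \<in> Z p" "f (xs, xs') = f (ys, ys')"
    have "xs @ map uminus xs' = ys @ map uminus ys'"
      using * cat by (intro inj_onD[OF num_inj[of "int m" "2 * int m + 1" "2 * n"]])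
        (simp_all add: f_def)
    moreover have "length xs = length ys" using * by (auto simp: Z_def W_def split: prod.splits)
    ultimately show "xs = ys \<and> xs' = ys'"
      by (simp add: inj_map_eq_map)
  qed
  moreover have "f ` (Z p \<times> Z p) \<subseteq> diffset (simplex_set m (2 * n) L) (simplex_set m (2 * n) L)"
  proof clarify
    fix zs zs' assume "zs \<in> Z p" "zs' \<in> Z p"
    note cat[OF this]
    then show "f (zs, zs') \<in> diffset (simplex_set m (2 * n) L) (simplex_set m (2 * n) L)"
      unfolding f_def prod.case by (intro simplex_diffset_memI) linarith+
  qed
  ultimately have "card (Z p) * card (Z p)
      \<le> card (diffset (simplex_set m (2 * n) L) (simplex_set m (2 * n) L))"
    by (metis card_cartesian_product card_image card_mono finite_diffset finite_simplex_set)
  then have *: "real (card (Z p)) * real (card (Z p))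
      \<le> real (card (diffset (simplex_set m (2 * n) L) (simplex_set m (2 * n) L)))"
    by (metis of_nat_le_iff of_nat_mult)
  have "0 \<le> S" unfolding S_def using assms by (intro sum_nonneg) auto
  \<comment> \<open>Squaring corresponds to pairing words, and turns the pigeonhole loss into a
    fourth power.\<close>
  then have "(S ^ n)\<^sup>2 \<le> ((real (m * n) + 1)\<^sup>2 * (real (card (Z p)) * t ^ L))\<^sup>2"
    using S_le by (intro power_mono) (auto simp: L_def)
  also have "\<dots> = (real (m * n) + 1) ^ 4 * (t ^ (2 * L) * (real (card (Z p)) * real (card (Z p))))"
    unfolding mult_2 power_add by (simp add: power2_eq_square power4_eq_xxxx)
  also have "\<dots> \<le> (real (m * n) + 1) ^ 4 * (t ^ (2 * L) *
      real (card (diffset (simplex_set m (2 * n) L) (simplex_set m (2 * n) L))))"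
    using * assms by (intro mult_left_mono) auto
  finally show ?thesis
    using that[of L] by (simp add: S_def power_mult[symmetric] mult.commute)
qed

section \<open>Choice of the parameters and numerical bounds\<close>

lemma exists_power_dominates:
  fixes a \<rho> :: real
  assumes "\<rho> > 1" "a \<ge> 0" "k > 0"
  obtains N :: nat where "(a * real N + 1) ^ k < \<rho> ^ N"
proof -
  \<comment> \<open>Taking \<open>k\<close>-th roots leaves a linear function against the
    exponential \<open>x ^ N\<close>.\<close>
  define x where "x = root k \<rho>"
  have x: "x > 1" "x ^ k = \<rho>" using assms by (auto simp: x_def)
  have "(\<lambda>n. real n * (1 / x) ^ n) \<longlonglongrightarrow> 0"
    using x(1) by (intro powser_times_n_limit_0) auto
  then have "eventually (\<lambda>n. real n * (1 / x) ^ n < 1 / (a + 1)) sequentially"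
    using assms by (intro order_tendstoD(2)) auto
  moreover have "eventually (\<lambda>n. n \<ge> 1) sequentially" by (rule eventually_ge_at_top)
  ultimately obtain N where N: "real N * (1 / x) ^ N < 1 / (a + 1)" "N \<ge> 1"
    by (metis (mono_tags, lifting) eventually_conj eventually_happens' trivial_limit_sequentially)
  have "a * real N + 1 \<le> (a + 1) * real N" using N(2) by (simp add: algebra_simps)
  also have "\<dots> < x ^ N"
    using N(1) x assms by (simp add: power_divide field_simps)
  finally have "(a * real N + 1) ^ k < (x ^ N) ^ k"
    using assms by (intro power_strict_mono) auto
  then show ?thesis using that x by (metis power_commutes power_mult mult.commute)
qed

lemma exists_good_set:
  obtains U :: "int set" where "finite U" "\<forall>u\<in>U. 0 \<le> u" "0 \<in> U" "Max U > 0"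
    "1 + ln (real (card (diffset U U)) / real (card (U + U)))
      / ln (2 * real_of_int (Max U) + 1) \<ge> 1.173050"
proof -
  \<comment> \<open>Near the maximum of \<open>S / R\<close>, attained at about \<open>t = 0.6261\<close>.\<close>
  define t :: real where "t = 62 / 99"
  have t: "0 < t" "t \<le> 1" by (simp_all add: t_def)
  define S where "S = (\<Sum>x\<in>{- int 5..int 5}. t ^ nat \<bar>x\<bar>)"
  define R where "R = (\<Sum>x\<in>{0..2 * int 5}. t ^ nat x)"
  have "{0..10::int} = {0,1,2,3,4,5,6,7,8,9,10}"
    by (force simp: set_upto[symmetric] upto.simps simp del: set_upto)
  then have R_eq: "R = 1 + t + t^2 + t^3 + t^4 + t^5 + t^6 + t^7 + t^8 + t^9 + t^10"
    by (simp add: R_def)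
  have "{-5..5::int} = {-5,-4,-3,-2,-1,0,1,2,3,4,5}"
    by (force simp: set_upto[symmetric] upto.simps simp del: set_upto)
  then have S_eq: "S = 1 + 2 * t + 2 * t^2 + 2 * t^3 + 2 * t^4 + 2 * t^5"
    by (simp add: S_def)
  have R: "R > 0" unfolding R_eq using t by (intro add_pos_pos) auto
  \<comment> \<open>The fraction of least denominator between \<open>11 powr (9 / 52)\<close> and \<open>S / R\<close>.\<close>
  have "3733 / 2465 \<le> S / R"
    unfolding S_eq R_eq t_def by (simp add: power_divide)
  then have "(3733 / 2465) ^ 52 \<le> (S / R) ^ 52" by (intro power_mono) auto
  moreover have "(11::real) ^ 9 < (3733 / 2465) ^ 52" by (simp add: power_divide)
  \<comment> \<open>Equivalently \<open>ln (S / R) / ln 11 > 9 / 52\<close>, where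
    \<open>9 / 52 = 0.17307...\<close> suffices for the claim; integer powers avoid estimating
    logarithms.\<close>
  ultimately have SR: "11 ^ 9 < (S / R) ^ 52" by linarith
  \<comment> \<open>The surplus per block of 52 digits, whose powers absorb the polynomial loss.
    Words of length \<open>52 * N = 2 * (26 * N)\<close> with \<open>m = 5\<close> lose
    \<open>(130 * N + 1) ^ 4\<close>.\<close>
  define \<rho> where "\<rho> = (S / R) ^ 52 / 11 ^ 9"
  have "\<rho> > 1" using SR by (simp add: \<rho>_def)
  then obtain N where N: "(130 * real N + 1) ^ 4 < \<rho> ^ N"
    by (rule exists_power_dominates[of _ 130 4]) auto
  obtain L where L: "S ^ (2 * (26 * N)) \<le> (real (5 * (26 * N)) + 1) ^ 4 *
    (t ^ (2 * L) * real (card (diffset (simplex_set 5 (2 * (26 * N)) L) (simplex_set 5 (2 * (26 * N)) L))))"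
    using card_simplex_diffset_ge[OF t(1), of 5 "26 * N"] unfolding S_def by blast
  define U where "U = simplex_set 5 (52 * N) L"
  define D where "D = card (diffset U U)"
  define s where "s = card (U + U)"
  have U: "finite U" "\<forall>u\<in>U. 0 \<le> u" "0 \<in> U"
    by (auto simp: U_def finite_simplex_set zero_in_simplex_set simplex_set_bounds)
  have "0 \<in> U + U" using U(3) by (force simp: set_plus_def)
  then have s: "s > 0" using U by (auto simp: s_def card_gt_0_iff finite_set_plus)
  have N_pos: "N > 0" using N by (cases N) auto
  have "t ^ (2 * L) * real s \<le> R ^ (52 * N)"
    using card_simplex_sumset_le[OF t, of L 5 "52 * N"] by (simp add: s_def U_def R_def)
  moreover have "S ^ (52 * N) \<le> (130 * real N + 1) ^ 4 * (t ^ (2 * L) * real D)"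
    using L by (simp add: D_def U_def mult.assoc[symmetric])
  moreover have "S ^ (52 * N) = \<rho> ^ N * 11 ^ (9 * N) * R ^ (52 * N)"
    using R by (simp add: \<rho>_def power_mult power_divide)
  \<comment> \<open>Eliminate \<open>R ^ (52 * N)\<close> between the upper bound for sums and the
    lower bound for differences.\<close>
  ultimately have "\<rho> ^ N * (11 ^ (9 * N) * (t ^ (2 * L) * real s)) \<le> (130 * real N + 1) ^ 4 * (t ^ (2 * L) * real D)"
    using \<open>\<rho> > 1\<close> by (smt (verit) mult.assoc mult_left_mono zero_le_power)
  also have "\<dots> \<le> \<rho> ^ N * (t ^ (2 * L) * real D)"
    using N t by (intro mult_right_mono) auto
  finally have "11 ^ (9 * N) * (t ^ (2 * L) * real s) \<le> t ^ (2 * L) * real D"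
    using \<open>\<rho> > 1\<close> by (simp add: mult_le_cancel_left)
  then have "t ^ (2 * L) * (11 ^ (9 * N) * real s) \<le> t ^ (2 * L) * real D"
    by (simp add: ac_simps)
  then have "11 ^ (9 * N) * real s \<le> real D"
    using t by simp
  then have ratio: "11 ^ (9 * N) \<le> real D / real s"
    using s by (simp add: le_divide_eq)
  have Max_in: "Max U \<in> U" using U by (intro Max_in) auto
  have Max_pos: "Max U > 0"
  \<comment> \<open>Otherwise \<open>U = {0}\<close>, with ratio 1, against the exponential lower
    bound just obtained.\<close>
  proof (rule ccontr)
    assume "\<not> Max U > 0"
    then have "u \<le> 0" if "u \<in> U" for u using Max_ge[OF U(1) that] by linarith
    then have "U = {0}" using U(2,3) by (auto intro: antisym)
    then have "D = 1" "s = 1" by (auto simp: D_def s_def diffset_def set_plus_def)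
    moreover have "(1::real) < 11 ^ (9 * N)" using N_pos by (intro one_less_power) auto
    ultimately show False using ratio by simp
  qed
  have "2 * Max U + 1 \<le> 11 ^ (52 * N)"
    using simplex_set_bounds(2)[of "Max U" 5 "52 * N" L] Max_in by (simp add: U_def)
  then have "real_of_int (2 * Max U + 1) \<le> real_of_int (11 ^ (52 * N))"
    by (simp only: of_int_le_iff)
  then have "ln (2 * real_of_int (Max U) + 1) \<le> ln (11 ^ (52 * N))"
    using Max_pos by (intro ln_mono) auto
  then have "9 / 52 * ln (2 * real_of_int (Max U) + 1) \<le> ln (11 ^ (9 * N))"
    by (simp add: ln_realpow)
  also have "\<dots> \<le> ln (real D / real s)"
    using ratio by (intro ln_mono) auto
  finally have "9 / 52 \<le> ln (real D / real s) / ln (2 * real_of_int (Max U) + 1)"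
    using Max_pos by (simp add: le_divide_eq)
  then show ?thesis
    using that[OF U Max_pos] by (simp add: D_def s_def)
qed

theorem mainTheorem1:
  shows "(\<exists>U :: int set. finite U \<and> (\<forall>u\<in>U. 0 \<le> u) \<and> 0 \<in> U \<and>
            1 + ln (real (card (diffset U U)) / real (card (U + U)))
                  / ln (2 * real_of_int (Max U) + 1) \<ge> 1.173050)
         \<and> (\<forall>K>1. sumdiff_exponent K \<ge> 1.173050)"
proof -
  obtain U :: "int set" where U: "finite U" "\<forall>u\<in>U. 0 \<le> u" "0 \<in> U" "Max U > 0"
    and bound: "1 + ln (real (card (diffset U U)) / real (card (U + U)))
      / ln (2 * real_of_int (Max U) + 1) \<ge> 1.173050"
    by (rule exists_good_set)
  have "sumdiff_exponent K \<ge> 1.173050" if "K > 1" for K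
    \<comment> \<open>The bound 2 on admissible exponents lets the supremum dominate each of
      them.\<close>
    unfolding sumdiff_exponent_def
    using admissible_exponent_GHR[OF U that] bound admissible_exponent_le_2
    by (intro cSup_upper2[where x = "1 + ln (real (card (diffset U U)) / real (card (U + U)))
      / ln (2 * real_of_int (Max U) + 1)"] bdd_aboveI[where M = 2]) auto
  then show ?thesis using U bound by blast
qed

end
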